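(* Let $X$ and $\Omega$ be non-empty sets, and let $j_X$ denote the natural embedding $X\to\mathcal{M}(X,\Omega)$ or $X\to\mathcal{S}(X,\Omega)$. (a) With the word concatenation product, the triple $(\mathcal{M}(X,\Omega),\{\lfloor_\omega\ \rfloor_\omega\mid\omega\in\Omega\},j_X)$ is the free $\Omega$-operated monoid on $X$. (b) With the word concatenation product, the triple $(\mathcal{S}(X,\Omega),\{\lfloor_\omega\ \rfloor_\omega\mid\omega\in\Omega\},j_X)$ is the free $\Omega$-operated semigroup on $X$.
   Context: **Operated semigroups and monoids.** An $\Omega$-operated semigroup (resp. monoid) is a semigroup (resp. monoid) $U$ together with a family of maps of sets $\alpha_\omega:U\to U$, $\omega\in\Omega$ (no compatibility with the product is required). A morphism is a semigroup (resp. monoid) homomorphism commuting with the operators indexed by each $\omega$. The free $\Omega$-operated semigroup (resp. monoid) on $X$ is an $\Omega$-operated semigroup (resp. monoid) $U_X$ with a map $j_X:X\to U_X$ such that for every $\Omega$-operated semigroup (resp. monoid) $V$ and map $f:X\to V$ there is a unique morphism $\bar f:U_X\to V$ with $f=\bar f\circ j_X$. **Bracketed words.** For a set $Y$, let $S(Y)$ be the free semigroup and $M(Y)$ the free monoid on $Y$. For $\omega\in\Omega$ let $\lfloor_\omega Y\rfloor_\omega=\{\lfloor_\omega y\rfloor_\omega\mid y\in Y\}$ be a set of formal symbols in bijection with $Y$ and disjoint from $Y$; these sets are pairwise disjoint as $\omega$ varies. Put $\mathcal{S}_0=S(X)$, $\mathcal{M}_0=M(X)$ and, for $n\ge1$,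 $\mathcal{S}_n=S\big(X\cup\bigcup_{\omega\in\Omega}\lfloor_\omega\mathcal{S}_{n-1}\rfloor_\omega\big)$, $\mathcal{M}_n=M\big(X\cup\bigcup_{\omega\in\Omega}\lfloor_\omega\mathcal{M}_{n-1}\rfloor_\omega\big)$, with the natural inclusions $\mathcal{S}_{n-1}\hookrightarrow\mathcal{S}_n$, $\mathcal{M}_{n-1}\hookrightarrow\mathcal{M}_n$ defined inductively. Set $\mathcal{S}(X,\Omega)=\bigcup_{n}\mathcal{S}_n$ and $\mathcal{M}(X,\Omega)=\bigcup_n\mathcal{M}_n$ (direct limits), with operators $\mathfrak{m}\mapsto\lfloor_\omega\mathfrak{m}\rfloor_\omega$, $\omega\in\Omega$. *)

theory Defs
  imports "HOL-Algebra.Group"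
begin

section \<open>Operated monoids and operated semigroups\<close>

text \<open>
  Structures are carrier-based. The index set \<open>\<Omega>\<close> is a set, so the family of
  operators is only required to be well behaved at indices in \<open>\<Omega>\<close>.
\<close>

record ('a, 'o) op_monoid = "'a monoid" +
  mop :: "'o \<Rightarrow> 'a \<Rightarrow> 'a"

locale operated_monoid = monoid U for U :: "('a, 'o) op_monoid" (structure) +
  fixes \<Omega> :: "'o set"
  assumes mop_closed: "\<omega> \<in> \<Omega> \<Longrightarrow> mop U \<omega> \<in> carrier U \<rightarrow> carrier U"

text \<open>\<^const>\<open>hom\<close> only asks for compatibility with products, so preservation of the unit is added.\<close>

definition op_monoid_hom ::
    "'o set \<Rightarrow> ('a, 'o) op_monoid \<Rightarrow> ('b, 'o) op_monoid \<Rightarrow> ('a \<Rightarrow> 'b) set" where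
  "op_monoid_hom \<Omega> U V =
     {h \<in> hom U V. h \<one>\<^bsub>U\<^esub> = \<one>\<^bsub>V\<^esub> \<and>
        (\<forall>\<omega>\<in>\<Omega>. \<forall>u\<in>carrier U. h (mop U \<omega> u) = mop V \<omega> (h u))}"

record ('a, 'o) op_semigroup = "'a partial_object" +
  sg_mult :: "'a \<Rightarrow> 'a \<Rightarrow> 'a" (infixl \<open>\<cdot>\<index>\<close> 70)
  sop :: "'o \<Rightarrow> 'a \<Rightarrow> 'a"

locale operated_semigroup =
  fixes U :: "('a, 'o) op_semigroup" (structure) and \<Omega> :: "'o set"
  assumes sg_closed: "\<lbrakk>x \<in> carrier U; y \<in> carrier U\<rbrakk> \<Longrightarrow> x \<cdot> y \<in> carrier U"
    and sg_assoc: "\<lbrakk>x \<in> carrier U; y \<in> carrier U; z \<in> carrier U\<rbrakk>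
                    \<Longrightarrow> (x \<cdot> y) \<cdot> z = x \<cdot> (y \<cdot> z)"
    and sop_closed: "\<omega> \<in> \<Omega> \<Longrightarrow> sop U \<omega> \<in> carrier U \<rightarrow> carrier U"

definition op_semigroup_hom ::
    "'o set \<Rightarrow> ('a, 'o) op_semigroup \<Rightarrow> ('b, 'o) op_semigroup \<Rightarrow> ('a \<Rightarrow> 'b) set" where
  "op_semigroup_hom \<Omega> U V =
     {h \<in> carrier U \<rightarrow> carrier V.
        (\<forall>x\<in>carrier U. \<forall>y\<in>carrier U. h (x \<cdot>\<^bsub>U\<^esub> y) = h x \<cdot>\<^bsub>V\<^esub> h y) \<and>
        (\<forall>\<omega>\<in>\<Omega>. \<forall>u\<in>carrier U. h (sop U \<omega> u) = sop V \<omega> (h u))}"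


section \<open>Free objects\<close>

text \<open>
  HOL cannot quantify over types inside a formula, so the element type \<open>'v\<close> of the test
  objects \<open>V\<close> is an explicit parameter; left as a type variable in a theorem, it ranges
  over all types. A map defined on \<open>carrier U\<close> is represented by the function that is
  \<open>undefined\<close> off the carrier (\<^const>\<open>extensional\<close>), so that \<open>\<exists>!\<close> means uniqueness
  on the carrier.
\<close>

definition is_free_operated_monoid ::
    "'v itself \<Rightarrow> 'o set \<Rightarrow> 'x set \<Rightarrow> ('u, 'o) op_monoid \<Rightarrow> ('x \<Rightarrow> 'u) \<Rightarrow> bool" where
  "is_free_operated_monoid (_ :: 'v itself) \<Omega> X U j \<longleftrightarrow>
     operated_monoid U \<Omega> \<and> j \<in> X \<rightarrow> carrier U \<and>
     (\<forall>(V :: ('v, 'o) op_monoid) f. operated_monoid V \<Omega> \<longrightarrow> f \<in> X \<rightarrow> carrier V \<longrightarrow>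
        (\<exists>!h. h \<in> extensional (carrier U) \<and> h \<in> op_monoid_hom \<Omega> U V \<and>
              (\<forall>x\<in>X. f x = h (j x))))"

definition is_free_operated_semigroup ::
    "'v itself \<Rightarrow> 'o set \<Rightarrow> 'x set \<Rightarrow> ('u, 'o) op_semigroup \<Rightarrow> ('x \<Rightarrow> 'u) \<Rightarrow> bool" where
  "is_free_operated_semigroup (_ :: 'v itself) \<Omega> X U j \<longleftrightarrow>
     operated_semigroup U \<Omega> \<and> j \<in> X \<rightarrow> carrier U \<and>
     (\<forall>(V :: ('v, 'o) op_semigroup) f. operated_semigroup V \<Omega> \<longrightarrow> f \<in> X \<rightarrow> carrier V \<longrightarrow>
        (\<exists>!h. h \<in> extensional (carrier U) \<and> h \<in> op_semigroup_hom \<Omega> U V \<and>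
              (\<forall>x\<in>X. f x = h (j x))))"


section \<open>Bracketed words\<close>

text \<open>
  \<open>letter\<close> is an ambient type of formal symbols: \<open>Bracket \<omega> w\<close> is the symbol
  \<open>\<lfloor>\<^sub>\<omega> w \<rfloor>\<^sub>\<omega>\<close>. Freeness of the constructors gives the required bijectivity and
  disjointness, and it turns the natural inclusions between consecutive stages into
  literal subset inclusions, so that the direct limits are unions.
\<close>

datatype ('x, 'o) letter = Gen 'x | Bracket 'o "('x, 'o) letter list"

definition free_monoid_words :: "'a set \<Rightarrow> 'a list set" where
  "free_monoid_words Y = lists Y"

definition free_semigroup_words :: "'a set \<Rightarrow> 'a list set" where
  "free_semigroup_words Y = lists Y - {[]}"

primrec M_stage :: "'x set \<Rightarrow> 'o set \<Rightarrow> nat \<Rightarrow> ('x, 'o) letter list set" where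
  "M_stage X \<Omega> 0 = free_monoid_words (Gen ` X)"
| "M_stage X \<Omega> (Suc n) =
     free_monoid_words (Gen ` X \<union> (\<Union>\<omega>\<in>\<Omega>. Bracket \<omega> ` M_stage X \<Omega> n))"

primrec S_stage :: "'x set \<Rightarrow> 'o set \<Rightarrow> nat \<Rightarrow> ('x, 'o) letter list set" where
  "S_stage X \<Omega> 0 = free_semigroup_words (Gen ` X)"
| "S_stage X \<Omega> (Suc n) =
     free_semigroup_words (Gen ` X \<union> (\<Union>\<omega>\<in>\<Omega>. Bracket \<omega> ` S_stage X \<Omega> n))"

lemma M_stage_mono: "M_stage X \<Omega> n \<subseteq> M_stage X \<Omega> (Suc n)"
proof (induction n)
  case 0
  show ?case by (auto simp: free_monoid_words_def)
next
  case (Suc n)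
  have "Gen ` X \<union> (\<Union>\<omega>\<in>\<Omega>. Bracket \<omega> ` M_stage X \<Omega> n)
      \<subseteq> Gen ` X \<union> (\<Union>\<omega>\<in>\<Omega>. Bracket \<omega> ` M_stage X \<Omega> (Suc n))"
    using Suc.IH by blast
  then show ?case
    unfolding M_stage.simps(2)[of X \<Omega> n] M_stage.simps(2)[of X \<Omega> "Suc n"] free_monoid_words_def
    by (rule lists_mono)
qed

lemma S_stage_mono: "S_stage X \<Omega> n \<subseteq> S_stage X \<Omega> (Suc n)"
proof (induction n)
  case 0
  show ?case by (auto simp: free_semigroup_words_def)
next
  case (Suc n)
  have "Gen ` X \<union> (\<Union>\<omega>\<in>\<Omega>. Bracket \<omega> ` S_stage X \<Omega> n)
      \<subseteq> Gen ` X \<union> (\<Union>\<omega>\<in>\<Omega>. Bracket \<omega> ` S_stage X \<Omega> (Suc n))"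
    using Suc.IH by blast
  then show ?case
    unfolding S_stage.simps(2)[of X \<Omega> n] S_stage.simps(2)[of X \<Omega> "Suc n"] free_semigroup_words_def
    by (intro Diff_mono lists_mono) auto
qed

definition M_words :: "'x set \<Rightarrow> 'o set \<Rightarrow> ('x, 'o) letter list set" where
  "M_words X \<Omega> = (\<Union>n. M_stage X \<Omega> n)"

definition S_words :: "'x set \<Rightarrow> 'o set \<Rightarrow> ('x, 'o) letter list set" where
  "S_words X \<Omega> = (\<Union>n. S_stage X \<Omega> n)"

definition M_bracketed :: "'x set \<Rightarrow> 'o set \<Rightarrow> (('x, 'o) letter list, 'o) op_monoid" where
  "M_bracketed X \<Omega> =
     \<lparr>carrier = M_words X \<Omega>, mult = (@), one = [], mop = (\<lambda>\<omega> w. [Bracket \<omega> w])\<rparr>"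

definition S_bracketed :: "'x set \<Rightarrow> 'o set \<Rightarrow> (('x, 'o) letter list, 'o) op_semigroup" where
  "S_bracketed X \<Omega> =
     \<lparr>carrier = S_words X \<Omega>, sg_mult = (@), sop = (\<lambda>\<omega> w. [Bracket \<omega> w])\<rparr>"

text \<open>The natural embedding of \<open>X\<close>, the same formula in both cases.\<close>

definition gen_word :: "'x \<Rightarrow> ('x, 'o) letter list" where
  "gen_word x = [Gen x]"

end

theory Submission
  imports Defs
begin

text \<open>
  Freeness has two halves, and each comes from one view of bracketed words.

  Existence of the extension uses that a bracketed word is a finite term: a map \<open>f\<close> on
  generators determines the value of every letter by recursion on bracket nesting, where
  \<open>\<lfloor>\<^sub>\<omega> w \<rfloor>\<^sub>\<omega>\<close> is sent to \<open>\<omega>\<close> applied to the product of the values of the letters of \<open>w\<close>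
  (\<open>eval_letter\<close>). A word is sent to the product of the values of its letters. The bracket
  operators are respected by construction, and concatenation is respected by associativity
  (\<open>foldr_mult_append\<close>, \<open>sg_prod_append\<close>).

  Uniqueness uses that bracketed words are generated: every word of every stage arises from
  generators by concatenation and bracketing (\<open>M_words_induct\<close>, \<open>S_words_induct\<close>), so
  two morphisms that agree on generators agree everywhere.

  The stages form increasing chains, so finitely many words always lie in a common stage;
  this is why the union is closed under concatenation.
\<close>

section \<open>Bracketed words are closed under the operations and generated by them\<close>

lemma Nil_in_M_words: "[] \<in> M_words X \<Omega>"
proof -
  have "[] \<in> M_stage X \<Omega> 0"
    by (simp add: free_monoid_words_def)
  then show ?thesis
    unfolding M_words_def by blast
qed

lemma gen_word_in_M_words: "x \<in> X \<Longrightarrow> gen_word x \<in> M_words X \<Omega>"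
proof -
  assume "x \<in> X"
  then have "gen_word x \<in> M_stage X \<Omega> 0"
    by (simp add: gen_word_def free_monoid_words_def)
  then show ?thesis
    unfolding M_words_def by blast
qed

lemma bracket_in_M_words:
  assumes "\<omega> \<in> \<Omega>" and "w \<in> M_words X \<Omega>"
  shows "[Bracket \<omega> w] \<in> M_words X \<Omega>"
proof -
  obtain n where "w \<in> M_stage X \<Omega> n"
    using assms(2) by (auto simp: M_words_def)
  then have "[Bracket \<omega> w] \<in> M_stage X \<Omega> (Suc n)"
    using assms(1) by (auto simp: free_monoid_words_def)
  then show ?thesis
    unfolding M_words_def by blast
qed

lemma append_in_M_words:
  assumes "u \<in> M_words X \<Omega>" and "v \<in> M_words X \<Omega>"
  shows "u @ v \<in> M_words X \<Omega>"
proof -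
  obtain m n where "u \<in> M_stage X \<Omega> m" "v \<in> M_stage X \<Omega> n"
    using assms by (auto simp: M_words_def)
  then have "u \<in> M_stage X \<Omega> (max m n)" "v \<in> M_stage X \<Omega> (max m n)"
    using lift_Suc_mono_le[of "M_stage X \<Omega>", OF M_stage_mono]
    by (meson max.cobounded1 max.cobounded2 subsetD)+
  then have "u @ v \<in> M_stage X \<Omega> (max m n)"
    by (cases "max m n") (auto simp: free_monoid_words_def)
  then show ?thesis
    unfolding M_words_def by blast
qed

lemma gen_word_in_S_words: "x \<in> X \<Longrightarrow> gen_word x \<in> S_words X \<Omega>"
proof -
  assume "x \<in> X"
  then have "gen_word x \<in> S_stage X \<Omega> 0"
    by (simp add: gen_word_def free_semigroup_words_def)
  then show ?thesis
    unfolding S_words_def by blast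
qed

lemma bracket_in_S_words:
  assumes "\<omega> \<in> \<Omega>" and "w \<in> S_words X \<Omega>"
  shows "[Bracket \<omega> w] \<in> S_words X \<Omega>"
proof -
  obtain n where "w \<in> S_stage X \<Omega> n"
    using assms(2) by (auto simp: S_words_def)
  then have "[Bracket \<omega> w] \<in> S_stage X \<Omega> (Suc n)"
    using assms(1) by (auto simp: free_semigroup_words_def)
  then show ?thesis
    unfolding S_words_def by blast
qed

lemma append_in_S_words:
  assumes "u \<in> S_words X \<Omega>" and "v \<in> S_words X \<Omega>"
  shows "u @ v \<in> S_words X \<Omega>"
proof -
  obtain m n where "u \<in> S_stage X \<Omega> m" "v \<in> S_stage X \<Omega> n"
    using assms by (auto simp: S_words_def)
  then have "u \<in> S_stage X \<Omega> (max m n)" "v \<in> S_stage X \<Omega> (max m n)"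
    using lift_Suc_mono_le[of "S_stage X \<Omega>", OF S_stage_mono]
    by (meson max.cobounded1 max.cobounded2 subsetD)+
  then have "u @ v \<in> S_stage X \<Omega> (max m n)"
    by (cases "max m n") (auto simp: free_semigroup_words_def)
  then show ?thesis
    unfolding S_words_def by blast
qed

text \<open>
  A word over \<open>Y\<close> is the concatenation of its one-letter words, so within a stage only
  one-letter words matter; a bracketed letter leads to a word of the previous stage.
\<close>

lemma lists_induct_append:
  assumes "w \<in> lists Y" and "P []" and "\<And>y. y \<in> Y \<Longrightarrow> P [y]"
    and "\<And>u v. \<lbrakk>u \<in> lists Y; v \<in> lists Y; P u; P v\<rbrakk> \<Longrightarrow> P (u @ v)"
  shows "P w"
  using assms(1)
proof (induction w)
  case Nil
  show ?case by (rule assms(2))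
next
  case (Cons y w)
  then show ?case
    using assms(3)[of y] assms(4)[of "[y]" w] by simp
qed

theorem M_words_induct [consumes 1, case_names Nil gen bracket append]:
  assumes "w \<in> M_words X \<Omega>"
    and Nil: "P []"
    and gen: "\<And>x. x \<in> X \<Longrightarrow> P (gen_word x)"
    and bracket: "\<And>\<omega> u. \<lbrakk>\<omega> \<in> \<Omega>; u \<in> M_words X \<Omega>; P u\<rbrakk> \<Longrightarrow> P [Bracket \<omega> u]"
    and append: "\<And>u v. \<lbrakk>u \<in> M_words X \<Omega>; v \<in> M_words X \<Omega>; P u; P v\<rbrakk> \<Longrightarrow> P (u @ v)"
  shows "P w"
proof -
  have words: "v \<in> M_words X \<Omega>" if "v \<in> M_stage X \<Omega> n" for v n
    using that unfolding M_words_def by blast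
  have "P v" if "v \<in> M_stage X \<Omega> n" for v n
    using that
  proof (induction n arbitrary: v)
    case 0
    then have "v \<in> lists (Gen ` X)"
      by (simp add: free_monoid_words_def)
    then show ?case
    proof (rule lists_induct_append)
      fix a b :: "('a, 'b) letter list"
      assume "a \<in> lists (Gen ` X)" "b \<in> lists (Gen ` X)" "P a" "P b"
      then show "P (a @ b)"
        using words[of a 0] words[of b 0] append by (simp add: free_monoid_words_def)
    qed (use Nil gen in \<open>auto simp: gen_word_def\<close>)
  next
    case (Suc n)
    let ?Y = "Gen ` X \<union> (\<Union>\<omega>\<in>\<Omega>. Bracket \<omega> ` M_stage X \<Omega> n)"
    have "v \<in> lists ?Y"
      using Suc.prems by (simp add: free_monoid_words_def)
    then show ?case
    proof (rule lists_induct_append)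
      fix a b :: "('a, 'b) letter list"
      assume "a \<in> lists ?Y" "b \<in> lists ?Y" "P a" "P b"
      then show "P (a @ b)"
        using words[of a "Suc n"] words[of b "Suc n"] append by (simp add: free_monoid_words_def)
    next
      fix y assume "y \<in> ?Y"
      then show "P [y]"
        using gen bracket Suc.IH words by (auto simp: gen_word_def)
    qed (rule Nil)
  qed
  then show ?thesis
    using assms(1) by (auto simp: M_words_def)
qed

text \<open>
  The empty word is admitted as a vacuous case of the inner induction, because a non-empty
  word may split into an empty and a non-empty part.
\<close>

theorem S_words_induct [consumes 1, case_names gen bracket append]:
  assumes "w \<in> S_words X \<Omega>"
    and gen: "\<And>x. x \<in> X \<Longrightarrow> P (gen_word x)"
    and bracket: "\<And>\<omega> u. \<lbrakk>\<omega> \<in> \<Omega>; u \<in> S_words X \<Omega>; P u\<rbrakk> \<Longrightarrow> P [Bracket \<omega> u]"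
    and append: "\<And>u v. \<lbrakk>u \<in> S_words X \<Omega>; v \<in> S_words X \<Omega>; P u; P v\<rbrakk> \<Longrightarrow> P (u @ v)"
  shows "P w"
proof -
  have words: "v \<in> S_words X \<Omega>" if "v \<in> S_stage X \<Omega> n" for v n
    using that unfolding S_words_def by blast
  have nonempty: "v \<noteq> []" if "v \<in> S_stage X \<Omega> n" for v n
    using that by (cases n) (auto simp: free_semigroup_words_def)
  have "v \<noteq> [] \<longrightarrow> P v" if "v \<in> S_stage X \<Omega> n" for v n
    using that
  proof (induction n arbitrary: v)
    case 0
    then have "v \<in> lists (Gen ` X)"
      by (simp add: free_semigroup_words_def)
    then show ?case
    proof (rule lists_induct_append)
      fix a b :: "('a, 'b) letter list"
      assume "a \<in> lists (Gen ` X)" "b \<in> lists (Gen ` X)" "a \<noteq> [] \<longrightarrow> P a" "b \<noteq> [] \<longrightarrow> P b"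
      then show "a @ b \<noteq> [] \<longrightarrow> P (a @ b)"
        using words[of a 0] words[of b 0] append
        by (cases "a = []"; cases "b = []") (simp_all add: free_semigroup_words_def)
    qed (use gen in \<open>auto simp: gen_word_def\<close>)
  next
    case (Suc n)
    let ?Y = "Gen ` X \<union> (\<Union>\<omega>\<in>\<Omega>. Bracket \<omega> ` S_stage X \<Omega> n)"
    have "v \<in> lists ?Y"
      using Suc.prems by (simp add: free_semigroup_words_def)
    then show ?case
    proof (rule lists_induct_append)
      fix a b :: "('a, 'b) letter list"
      assume "a \<in> lists ?Y" "b \<in> lists ?Y" "a \<noteq> [] \<longrightarrow> P a" "b \<noteq> [] \<longrightarrow> P b"
      then show "a @ b \<noteq> [] \<longrightarrow> P (a @ b)"
        using words[of a "Suc n"] words[of b "Suc n"] append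
        by (cases "a = []"; cases "b = []") (simp_all add: free_semigroup_words_def)
    next
      fix y assume "y \<in> ?Y"
      then show "[y] \<noteq> [] \<longrightarrow> P [y]"
        using gen bracket Suc.IH words nonempty by (auto simp: gen_word_def)
    qed simp
  qed
  then show ?thesis
    using assms(1) nonempty by (auto simp: S_words_def)
qed

section \<open>Evaluating bracketed words\<close>

text \<open>
  Monoids and semigroups differ only in how a list is multiplied out, so this product is a
  parameter \<open>p\<close>; \<open>act\<close> interprets the bracket operators.
\<close>

primrec eval_letter ::
    "('o \<Rightarrow> 'v \<Rightarrow> 'v) \<Rightarrow> ('v list \<Rightarrow> 'v) \<Rightarrow> ('x \<Rightarrow> 'v) \<Rightarrow> ('x, 'o) letter \<Rightarrow> 'v" where
  "eval_letter act p f (Gen x) = f x"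
| "eval_letter act p f (Bracket \<omega> w) = act \<omega> (p (map (eval_letter act p f) w))"

lemma (in monoid) foldr_mult_closed:
  "set vs \<subseteq> carrier G \<Longrightarrow> foldr (\<otimes>) vs \<one> \<in> carrier G"
  by (induction vs) auto

lemma (in monoid) foldr_mult_append:
  "\<lbrakk>set us \<subseteq> carrier G; set vs \<subseteq> carrier G\<rbrakk>
    \<Longrightarrow> foldr (\<otimes>) (us @ vs) \<one> = foldr (\<otimes>) us \<one> \<otimes> foldr (\<otimes>) vs \<one>"
proof (induction us)
  case Nil
  then show ?case by (simp add: foldr_mult_closed)
next
  case (Cons a us)
  then show ?case
    using foldr_mult_closed[of us] foldr_mult_closed[of vs] by (simp add: m_assoc)
qed

text \<open>
  A semigroup has no unit to start a fold from, so the last entry plays that part and the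
  product of the empty list is left unspecified.
\<close>

fun sg_prod :: "('v, 'o) op_semigroup \<Rightarrow> 'v list \<Rightarrow> 'v" where
  "sg_prod V [a] = a"
| "sg_prod V (a # b # vs) = a \<cdot>\<^bsub>V\<^esub> sg_prod V (b # vs)"

lemma sg_prod_Cons: "vs \<noteq> [] \<Longrightarrow> sg_prod V (a # vs) = a \<cdot>\<^bsub>V\<^esub> sg_prod V vs"
  by (cases vs) simp_all

lemma (in operated_semigroup) sg_prod_closed:
  assumes "vs \<noteq> []" and "set vs \<subseteq> carrier U"
  shows "sg_prod U vs \<in> carrier U"
  using assms by (induction vs rule: list_nonempty_induct) (auto simp: sg_prod_Cons sg_closed)

lemma (in operated_semigroup) sg_prod_append:
  assumes "us \<noteq> []" and "vs \<noteq> []" and "set us \<subseteq> carrier U" and "set vs \<subseteq> carrier U"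
  shows "sg_prod U (us @ vs) = sg_prod U us \<cdot> sg_prod U vs"
  using assms(1,3)
proof (induction us rule: list_nonempty_induct)
  case (single a)
  then show ?case
    using assms(2) by (simp add: sg_prod_Cons)
next
  case (cons a us)
  then show ?case
    using sg_prod_closed[of us] sg_prod_closed[of vs] assms(2,4)
    by (simp add: sg_prod_Cons sg_assoc)
qed

section \<open>The universal properties\<close>

lemma operated_monoid_M_bracketed: "operated_monoid (M_bracketed X \<Omega>) \<Omega>"
  by unfold_locales
    (auto simp: M_bracketed_def Nil_in_M_words append_in_M_words bracket_in_M_words)

lemma operated_semigroup_S_bracketed: "operated_semigroup (S_bracketed X \<Omega>) \<Omega>"
  by unfold_locales (auto simp: S_bracketed_def append_in_S_words bracket_in_S_words)

lemma op_monoid_hom_M_bracketed_unique: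
  assumes "h \<in> op_monoid_hom \<Omega> (M_bracketed X \<Omega>) V"
    and "k \<in> op_monoid_hom \<Omega> (M_bracketed X \<Omega>) V"
    and "\<And>x. x \<in> X \<Longrightarrow> h (gen_word x) = k (gen_word x)"
    and "w \<in> M_words X \<Omega>"
  shows "h w = k w"
  using assms(4)
proof (induction rule: M_words_induct)
  case Nil
  show ?case
    using assms(1,2) by (simp add: op_monoid_hom_def M_bracketed_def)
next
  case (gen x)
  then show ?case by (rule assms(3))
next
  case (bracket \<omega> u)
  then show ?case
    using assms(1,2) by (simp add: op_monoid_hom_def M_bracketed_def)
next
  case (append u v)
  then show ?case
    using assms(1,2) by (simp add: op_monoid_hom_def hom_def M_bracketed_def)
qed

lemma op_semigroup_hom_S_bracketed_unique:
  assumes "h \<in> op_semigroup_hom \<Omega> (S_bracketed X \<Omega>) V"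
    and "k \<in> op_semigroup_hom \<Omega> (S_bracketed X \<Omega>) V"
    and "\<And>x. x \<in> X \<Longrightarrow> h (gen_word x) = k (gen_word x)"
    and "w \<in> S_words X \<Omega>"
  shows "h w = k w"
  using assms(4)
proof (induction rule: S_words_induct)
  case (gen x)
  then show ?case by (rule assms(3))
next
  case (bracket \<omega> u)
  then show ?case
    using assms(1,2) by (simp add: op_semigroup_hom_def S_bracketed_def)
next
  case (append u v)
  then show ?case
    using assms(1,2) by (simp add: op_semigroup_hom_def S_bracketed_def)
qed

lemma op_monoid_hom_M_bracketed_exists:
  fixes V :: "('v, 'o) op_monoid" (structure)
  assumes "operated_monoid V \<Omega>" and f: "f \<in> X \<rightarrow> carrier V"
  shows "\<exists>h \<in> extensional (M_words X \<Omega>).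
           h \<in> op_monoid_hom \<Omega> (M_bracketed X \<Omega>) V \<and> (\<forall>x\<in>X. f x = h (gen_word x))"
proof -
  interpret V: operated_monoid V \<Omega> by (rule assms(1))
  let ?p = "\<lambda>vs. foldr (\<otimes>) vs \<one>"
  define e where "e = eval_letter (mop V) ?p f"
  \<comment> \<open>The invariant concerns the single letters of a word, not only its value: the laws of \<open>V\<close>
    hold on its carrier, so a product can be split only if every factor lies there.\<close>
  have letters: "set (map e w) \<subseteq> carrier V" if "w \<in> M_words X \<Omega>" for w
    using that
  proof (induction rule: M_words_induct)
    case (gen x)
    then show ?case using f by (auto simp: e_def gen_word_def)
  next
    case (bracket \<omega> u)
    then have "mop V \<omega> (?p (map e u)) \<in> carrier V"
      using V.foldr_mult_closed V.mop_closed by blast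
    then show ?case by (simp add: e_def)
  qed auto
  define h where "h = restrict (\<lambda>w. ?p (map e w)) (M_words X \<Omega>)"
  have "h \<in> M_words X \<Omega> \<rightarrow> carrier V"
    using letters V.foldr_mult_closed by (simp add: h_def)
  moreover have "h (u @ v) = h u \<otimes> h v" if "u \<in> M_words X \<Omega>" "v \<in> M_words X \<Omega>" for u v
    using that V.foldr_mult_append[OF letters letters, of u v]
    by (simp add: h_def append_in_M_words del: foldr_append)
  ultimately have "h \<in> hom (M_bracketed X \<Omega>) V"
    by (simp add: hom_def M_bracketed_def)
  moreover have "h [Bracket \<omega> u] = mop V \<omega> (h u)" if "\<omega> \<in> \<Omega>" "u \<in> M_words X \<Omega>" for \<omega> u
  proof -
    have "mop V \<omega> (?p (map e u)) \<in> carrier V"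
      using that letters V.foldr_mult_closed V.mop_closed by blast
    then show ?thesis
      using that by (simp add: h_def e_def bracket_in_M_words)
  qed
  ultimately have "h \<in> op_monoid_hom \<Omega> (M_bracketed X \<Omega>) V"
    by (simp add: op_monoid_hom_def M_bracketed_def h_def Nil_in_M_words)
  moreover have "f x = h (gen_word x)" if "x \<in> X" for x
    using funcset_mem[OF f that] gen_word_in_M_words[OF that, of \<Omega>]
    by (simp add: h_def e_def gen_word_def)
  moreover have "h \<in> extensional (M_words X \<Omega>)"
    by (simp add: h_def)
  ultimately show ?thesis by blast
qed

lemma op_semigroup_hom_S_bracketed_exists:
  fixes V :: "('v, 'o) op_semigroup" (structure)
  assumes "operated_semigroup V \<Omega>" and f: "f \<in> X \<rightarrow> carrier V"
  shows "\<exists>h \<in> extensional (S_words X \<Omega>).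
           h \<in> op_semigroup_hom \<Omega> (S_bracketed X \<Omega>) V \<and> (\<forall>x\<in>X. f x = h (gen_word x))"
proof -
  interpret V: operated_semigroup V \<Omega> by (rule assms(1))
  define e where "e = eval_letter (sop V) (sg_prod V) f"
  \<comment> \<open>The invariant concerns the single letters of a word, not only its value: the laws of \<open>V\<close>
    hold on its carrier, so a product can be split only if every factor lies there.\<close>
  have letters: "map e w \<noteq> [] \<and> set (map e w) \<subseteq> carrier V" if "w \<in> S_words X \<Omega>" for w
    using that
  proof (induction rule: S_words_induct)
    case (gen x)
    then show ?case using f by (auto simp: e_def gen_word_def)
  next
    case (bracket \<omega> u)
    then have "sop V \<omega> (sg_prod V (map e u)) \<in> carrier V"
      using V.sg_prod_closed V.sop_closed by blast
    then show ?case by (simp add: e_def)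
  qed auto
  define h where "h = restrict (\<lambda>w. sg_prod V (map e w)) (S_words X \<Omega>)"
  have "h \<in> S_words X \<Omega> \<rightarrow> carrier V"
    using letters V.sg_prod_closed by (simp add: h_def)
  moreover have "h (u @ v) = h u \<cdot> h v" if "u \<in> S_words X \<Omega>" "v \<in> S_words X \<Omega>" for u v
    using that letters[of u] letters[of v] V.sg_prod_append[of "map e u" "map e v"]
    by (simp add: h_def append_in_S_words)
  moreover have "h [Bracket \<omega> u] = sop V \<omega> (h u)" if "\<omega> \<in> \<Omega>" "u \<in> S_words X \<Omega>" for \<omega> u
    using that by (simp add: h_def e_def bracket_in_S_words)
  ultimately have "h \<in> op_semigroup_hom \<Omega> (S_bracketed X \<Omega>) V"
    by (simp add: op_semigroup_hom_def S_bracketed_def)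
  moreover have "f x = h (gen_word x)" if "x \<in> X" for x
    using gen_word_in_S_words[OF that, of \<Omega>] by (simp add: h_def e_def gen_word_def)
  moreover have "h \<in> extensional (S_words X \<Omega>)"
    by (simp add: h_def)
  ultimately show ?thesis by blast
qed

lemma M_bracketed_free:
  fixes X :: "'x set" and \<Omega> :: "'o set"
  shows "is_free_operated_monoid TYPE('v) \<Omega> X (M_bracketed X \<Omega>) gen_word"
proof -
  have carrier: "carrier (M_bracketed X \<Omega>) = M_words X \<Omega>"
    by (simp add: M_bracketed_def)
  have "\<exists>!h. h \<in> extensional (M_words X \<Omega>) \<and> h \<in> op_monoid_hom \<Omega> (M_bracketed X \<Omega>) V \<and>
              (\<forall>x\<in>X. f x = h (gen_word x))"
    if "operated_monoid V \<Omega>" "f \<in> X \<rightarrow> carrier V" for V :: "('v, 'o) op_monoid" and f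
  proof (rule ex_ex1I)
    show "\<exists>h. h \<in> extensional (M_words X \<Omega>) \<and> h \<in> op_monoid_hom \<Omega> (M_bracketed X \<Omega>) V \<and>
              (\<forall>x\<in>X. f x = h (gen_word x))"
      using op_monoid_hom_M_bracketed_exists[OF that] by blast
  next
    fix h k
    assume "h \<in> extensional (M_words X \<Omega>) \<and> h \<in> op_monoid_hom \<Omega> (M_bracketed X \<Omega>) V \<and>
              (\<forall>x\<in>X. f x = h (gen_word x))"
      and "k \<in> extensional (M_words X \<Omega>) \<and> k \<in> op_monoid_hom \<Omega> (M_bracketed X \<Omega>) V \<and>
              (\<forall>x\<in>X. f x = k (gen_word x))"
    then show "h = k"
      using op_monoid_hom_M_bracketed_unique[of h \<Omega> X V k] by (metis extensionalityI)
  qed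
  then show ?thesis
    unfolding is_free_operated_monoid_def carrier
    by (intro conjI allI impI operated_monoid_M_bracketed funcsetI gen_word_in_M_words)
qed

lemma S_bracketed_free:
  fixes X :: "'x set" and \<Omega> :: "'o set"
  shows "is_free_operated_semigroup TYPE('w) \<Omega> X (S_bracketed X \<Omega>) gen_word"
proof -
  have carrier: "carrier (S_bracketed X \<Omega>) = S_words X \<Omega>"
    by (simp add: S_bracketed_def)
  have "\<exists>!h. h \<in> extensional (S_words X \<Omega>) \<and> h \<in> op_semigroup_hom \<Omega> (S_bracketed X \<Omega>) V \<and>
              (\<forall>x\<in>X. f x = h (gen_word x))"
    if "operated_semigroup V \<Omega>" "f \<in> X \<rightarrow> carrier V" for V :: "('w, 'o) op_semigroup" and f
  proof (rule ex_ex1I)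
    show "\<exists>h. h \<in> extensional (S_words X \<Omega>) \<and> h \<in> op_semigroup_hom \<Omega> (S_bracketed X \<Omega>) V \<and>
              (\<forall>x\<in>X. f x = h (gen_word x))"
      using op_semigroup_hom_S_bracketed_exists[OF that] by blast
  next
    fix h k
    assume "h \<in> extensional (S_words X \<Omega>) \<and> h \<in> op_semigroup_hom \<Omega> (S_bracketed X \<Omega>) V \<and>
              (\<forall>x\<in>X. f x = h (gen_word x))"
      and "k \<in> extensional (S_words X \<Omega>) \<and> k \<in> op_semigroup_hom \<Omega> (S_bracketed X \<Omega>) V \<and>
              (\<forall>x\<in>X. f x = k (gen_word x))"
    then show "h = k"
      using op_semigroup_hom_S_bracketed_unique[of h \<Omega> X V k] by (metis extensionalityI)
  qed
  then show ?thesis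
    unfolding is_free_operated_semigroup_def carrier
    by (intro conjI allI impI operated_semigroup_S_bracketed funcsetI gen_word_in_S_words)
qed

theorem corollary3p6:
  fixes X :: "'x set" and \<Omega> :: "'o set"
  assumes "X \<noteq> {}" and "\<Omega> \<noteq> {}"
  shows "is_free_operated_monoid TYPE('v) \<Omega> X (M_bracketed X \<Omega>) gen_word \<and>
         is_free_operated_semigroup TYPE('w) \<Omega> X (S_bracketed X \<Omega>) gen_word"
  by (intro conjI M_bracketed_free S_bracketed_free)

end
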